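(* Let $p$ be a positive integer. For irreducible fractions $\frac{a}{p},\frac{b}{p}$ with $ab\equiv -1\pmod p$, we have $\mathcal{S}_{\frac{a}{p}}(q)=\mathcal{S}_{\frac{b}{p}}(q)$.
   Context: For an integer $c$, $[c]_q=\frac{1-q^c}{1-q}$. Every rational $\alpha>1$ has a unique negative continued fraction expansion $\alpha=c_1-\cfrac{1}{c_2-\cfrac{1}{\ddots-\cfrac{1}{c_l}}}$ with integers $c_j\ge 2$. Put $M^-_q(c)=\begin{pmatrix}[c]_q & -q^{c-1}\\ 1 & 0\end{pmatrix}$ and define $\mathcal{R}_\alpha(q),\mathcal{S}_\alpha(q)$ by $\begin{pmatrix}\mathcal{R}_\alpha(q)\\ \mathcal{S}_\alpha(q)\end{pmatrix}=M^-_q(c_1)\cdots M^-_q(c_l)\begin{pmatrix}1\\0\end{pmatrix}$. For rational $\alpha\le 1$ these are defined recursively by $\mathcal{S}_\alpha(q)=\mathcal{S}_{\alpha+1}(q)$ and $\mathcal{R}_\alpha(q)=q^{-1}(\mathcal{R}_{\alpha+1}(q)-\mathcal{S}_{\alpha+1}(q))$. An irreducible fraction $\frac{r}{s}$ means $\gcd(r,s)=1$, $s>0$. *)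

theory Defs
  imports
    "HOL-Analysis.Cartesian_Space"
    "HOL-Computational_Algebra.Fraction_Field"
    "HOL-Computational_Algebra.Polynomial"
    "HOL-Number_Theory.Cong"
begin

text \<open>
  All q-deformations live in the field of rational functions in the indeterminate \<open>q\<close>,
  realised as the fraction field of the integer polynomials. This field contains the
  negative powers of \<open>q\<close> that occur for rationals below 1.
\<close>

type_synonym qfun = "int poly fract"

definition qvar :: qfun where
  "qvar = Fraction_Field.Fract [:0, 1:] 1"

definition qint :: "int \<Rightarrow> qfun" where
  "qint c = (1 - qvar powi c) / (1 - qvar)"

definition Mq_minus :: "int \<Rightarrow> qfun ^ 2 ^ 2" where
  "Mq_minus c = vector [vector [qint c, - (qvar powi (c - 1))],
                        vector [1, 0]]"

fun neg_cfrac :: "int list \<Rightarrow> rat" where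
  "neg_cfrac [c] = of_int c"
| "neg_cfrac (c # d # cs) = of_int c - 1 / neg_cfrac (d # cs)"

definition is_neg_cf_expansion :: "rat \<Rightarrow> int list \<Rightarrow> bool" where
  "is_neg_cf_expansion \<alpha> cs \<longleftrightarrow> cs \<noteq> [] \<and> (\<forall>c \<in> set cs. c \<ge> 2) \<and> neg_cfrac cs = \<alpha>"

lemma neg_cfrac_Cons: "cs \<noteq> [] \<Longrightarrow> neg_cfrac (c # cs) = of_int c - 1 / neg_cfrac cs"
  by (cases cs) auto

lemma neg_cfrac_gt_1:
  assumes "cs \<noteq> []" "\<forall>c \<in> set cs. c \<ge> 2"
  shows "neg_cfrac cs > 1"
  using assms
proof (induction cs rule: neg_cfrac.induct)
  case (1 c)
  then show ?case by simp
next
  case (2 c d cs)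
  then have "neg_cfrac (d # cs) > 1" by simp
  then have "1 / neg_cfrac (d # cs) < 1" by simp
  moreover have "(2::rat) \<le> of_int c" using 2(3) by simp
  ultimately show ?case by simp
qed simp

lemma neg_cfrac_ceiling:
  assumes "\<forall>c \<in> set cs. c \<ge> 2"
  shows "\<lceil>neg_cfrac (c # cs)\<rceil> = c"
proof (cases "cs = []")
  case False
  then have "neg_cfrac cs > 1" using assms neg_cfrac_gt_1 by blast
  then have "0 < 1 / neg_cfrac cs" "1 / neg_cfrac cs < 1" by auto
  then show ?thesis
    by (simp add: neg_cfrac_Cons False ceiling_eq_iff)
qed simp

lemma is_neg_cf_expansion_unique:
  assumes "is_neg_cf_expansion \<alpha> cs" "is_neg_cf_expansion \<alpha> ds"
  shows "cs = ds"
  using assms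
proof (induction cs arbitrary: \<alpha> ds)
  case Nil
  then show ?case by (simp add: is_neg_cf_expansion_def)
next
  case (Cons c cs)
  obtain d ds' where ds: "ds = d # ds'"
    using Cons.prems(2) by (cases ds) (auto simp: is_neg_cf_expansion_def)
  have ge: "\<forall>c \<in> set cs. c \<ge> 2" "\<forall>c \<in> set ds'. c \<ge> 2"
    and val: "neg_cfrac (c # cs) = neg_cfrac (d # ds')"
    using Cons.prems by (auto simp: ds is_neg_cf_expansion_def)
  have cd: "c = d"
    using neg_cfrac_ceiling[OF ge(1), of c] neg_cfrac_ceiling[OF ge(2), of d] val by simp
  have ne: "neg_cfrac (e # es) \<noteq> of_int e" if "\<forall>c \<in> set es. c \<ge> 2" "es \<noteq> []" for e es
    using neg_cfrac_gt_1[OF that(2,1)] that(2) by (simp add: neg_cfrac_Cons)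
  show ?case
  proof (cases "cs = [] \<or> ds' = []")
    case True
    then show ?thesis
      using val ne[OF ge(1), of d] ne[OF ge(2), of d] unfolding ds cd
      by (metis neg_cfrac.simps(1))
  next
    case False
    then have "neg_cfrac cs = neg_cfrac ds'"
      using val by (auto simp: cd neg_cfrac_Cons)
    then have "cs = ds'"
      using Cons.IH[of "neg_cfrac ds'" ds'] False ge by (auto simp: is_neg_cf_expansion_def)
    then show ?thesis by (simp add: ds cd)
  qed
qed

lemma is_neg_cf_expansion_exists_int:
  fixes r s :: int
  assumes "0 < s" "s < r"
  shows "\<exists>cs. is_neg_cf_expansion (of_int r / of_int s) cs"
  using assms
proof (induction "nat s" arbitrary: r s rule: less_induct)
  case less
  define c where "c = - ((- r) div s)"
  define t where "t = (- r) mod s"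
  have t: "t = c * s - r"
    using div_mult_mod_eq[of "- r" s] unfolding c_def t_def by (simp only: mult_minus_left)
  have t_bounds: "0 \<le> t" "t < s"
    using less.prems by (simp_all add: t_def)
  have "1 * s < c * s" using t t_bounds less.prems by linarith
  then have c: "c \<ge> 2" using less.prems by (simp only: mult_less_cancel_right) auto
  have r: "rat_of_int r = of_int c * of_int s - of_int t"
    by (simp add: t)
  show ?case
  proof (cases "t = 0")
    case True
    then have "is_neg_cf_expansion (of_int r / of_int s) [c]"
      using c r less.prems by (simp add: is_neg_cf_expansion_def)
    then show ?thesis by blast
  next
    case False
    then obtain cs where cs: "is_neg_cf_expansion (of_int s / of_int t) cs"
      using less.hyps[of t s] t_bounds less.prems by auto
    have "rat_of_int c - 1 / (of_int s / of_int t) = of_int r / of_int s"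
      using less.prems by (simp add: r diff_divide_distrib)
    then have "is_neg_cf_expansion (of_int r / of_int s) (c # cs)"
      using cs c by (simp add: is_neg_cf_expansion_def neg_cfrac_Cons)
    then show ?thesis by blast
  qed
qed

lemma is_neg_cf_expansion_ex1:
  assumes "\<alpha> > 1"
  shows "\<exists>!cs. is_neg_cf_expansion \<alpha> cs"
proof -
  obtain r s where rs: "\<alpha> = of_int r / of_int s" "s > 0"
    by (metis quotient_of_denom_pos quotient_of_div surj_pair)
  then have "s < r" using assms by (simp add: less_divide_eq)
  then show ?thesis
    using rs is_neg_cf_expansion_exists_int is_neg_cf_expansion_unique by metis
qed

definition neg_cf :: "rat \<Rightarrow> int list" where
  "neg_cf \<alpha> = (THE cs. is_neg_cf_expansion \<alpha> cs)"

definition qRS_vec :: "rat \<Rightarrow> qfun ^ 2" where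
  "qRS_vec \<alpha> = foldr (\<lambda>c A. Mq_minus c ** A) (neg_cf \<alpha>) (mat 1) *v vector [1, 0]"

function qS :: "rat \<Rightarrow> qfun" where
  "qS \<alpha> = (if \<alpha> > 1 then qRS_vec \<alpha> $ 2 else qS (\<alpha> + 1))"
  by auto
termination
  by (relation "measure (\<lambda>\<alpha>. nat \<lceil>2 - \<alpha>\<rceil>)") (auto, linarith)

function qR :: "rat \<Rightarrow> qfun" where
  "qR \<alpha> = (if \<alpha> > 1 then qRS_vec \<alpha> $ 1 else inverse qvar * (qR (\<alpha> + 1) - qS (\<alpha> + 1)))"
  by auto
termination
  by (relation "measure (\<lambda>\<alpha>. nat \<lceil>2 - \<alpha>\<rceil>)") (auto, linarith)

declare qS.simps [simp del] qR.simps [simp del]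

end

theory Submission
  imports Defs
begin

text \<open>
  Let \<open>A = ((q, 1), (0, 1))\<close> and \<open>B = ((q, 0), (q, 1))\<close>. On the column \<open>(R\<^sub>x, S\<^sub>x)\<close> they act as
  the q-deformations of \<open>x \<mapsto> x + 1\<close> and \<open>x \<mapsto> x / (x + 1)\<close>. At \<open>q = 1\<close> they generate the monoid of
  nonnegative integer matrices of determinant 1. If \<open>0 \<le> a, b < p\<close> and \<open>a b = u p - 1\<close>, then
  \<open>((u, a), (b, p))\<close> is a word in \<open>A, B\<close> at \<open>q = 1\<close>, and \<open>S\<^bsub>a/p\<^esub>\<close> is the lower right entry of the
  same word over \<open>q\<close>. Transposition followed by conjugation with \<open>diag(q, 1)\<close> reverses words,
  swaps \<open>A\<close> with \<open>B\<close>, fixes lower right entries, and at \<open>q = 1\<close> exchanges \<open>a\<close> with \<open>b\<close>.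
\<close>

section \<open>Words in the two generators and their transposes\<close>

definition gen_mat :: "'a::comm_ring_1 \<Rightarrow> bool \<Rightarrow> 'a ^ 2 ^ 2" where
  "gen_mat q l = (if l then vector [vector [q, 0], vector [q, 1]]
                  else vector [vector [q, 1], vector [0, 1]])"

text \<open>Letters are booleans, \<open>False\<close> for \<open>A\<close> and \<open>True\<close>
  for \<open>B\<close>, so that \<open>Not\<close> swaps them. The ring is arbitrary, so that one
  word can be evaluated at \<open>1\<close> in the integers and at \<open>qvar\<close>.\<close>

definition word_mat :: "'a::comm_ring_1 \<Rightarrow> bool list \<Rightarrow> 'a ^ 2 ^ 2" where
  "word_mat q w = foldr (\<lambda>l M. gen_mat q l ** M) w (mat 1)"

lemma word_mat_simps [simp]:
  "word_mat q [] = mat 1"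
  "word_mat q (l # w) = gen_mat q l ** word_mat q w"
  by (simp_all add: word_mat_def)

lemma word_mat_append: "word_mat q (v @ w) = word_mat q v ** word_mat q w"
  by (induction v) (simp_all add: matrix_mul_assoc)

lemma gen_mat_transpose:
  fixes q :: "'a::comm_ring_1"
  defines "D \<equiv> vector [vector [q, 0], vector [0, 1]] :: 'a ^ 2 ^ 2"
  shows "transpose (gen_mat q l) ** D = D ** gen_mat q (\<not> l)"
  by (simp add: D_def gen_mat_def vec_eq_iff forall_2 transpose_def matrix_matrix_mult_def sum_2)

lemma word_mat_transpose:
  fixes q :: "'a::comm_ring_1"
  defines "D \<equiv> vector [vector [q, 0], vector [0, 1]] :: 'a ^ 2 ^ 2"
  shows "transpose (word_mat q w) ** D = D ** word_mat q (rev (map Not w))"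
proof (induction w)
  case Nil
  then show ?case by (simp add: transpose_mat)
next
  case (Cons l w)
  have "transpose (word_mat q (l # w)) ** D
      = transpose (word_mat q w) ** (transpose (gen_mat q l) ** D)"
    by (simp add: matrix_transpose_mul matrix_mul_assoc)
  also have "\<dots> = (transpose (word_mat q w) ** D) ** gen_mat q (\<not> l)"
    by (simp add: D_def gen_mat_transpose matrix_mul_assoc)
  also have "\<dots> = D ** word_mat q (rev (map Not (l # w)))"
    by (simp add: Cons.IH word_mat_append matrix_mul_assoc)
  finally show ?case .
qed

text \<open>Compare single entries in \<open>word_mat_transpose\<close>. The weight \<open>q\<close>
  of \<open>D\<close> misses the entry (2,2), but leaves a factor \<open>q\<close> on the entry
  (1,2), which disappears only at \<open>q = 1\<close>.\<close>

lemma word_mat_rev_nth: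
  fixes q :: "'a::comm_ring_1"
  shows "word_mat q (rev (map Not w)) $ 2 $ 2 = word_mat q w $ 2 $ 2"
    and "word_mat 1 (rev (map Not w)) $ 1 $ 2 = (word_mat 1 w $ 2 $ 1 :: 'a)"
  using arg_cong[OF word_mat_transpose[of q w], of "\<lambda>M. M $ 2 $ 2"]
    arg_cong[OF word_mat_transpose[of "1::'a" w], of "\<lambda>M. M $ 1 $ 2"]
  by (simp_all add: transpose_def matrix_matrix_mult_def sum_2)

text \<open>Euclidean algorithm on the rows: subtracting a row from an entrywise larger one strips a
  leading letter and lowers the entry sum, because \<open>u\<close> and \<open>p\<close> are
  positive.\<close>

lemma ex_word_mat:
  fixes u a b p :: int
  assumes "u \<ge> 0" "a \<ge> 0" "b \<ge> 0" "p \<ge> 0" "u * p - a * b = 1"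
  shows "\<exists>w. word_mat 1 w = vector [vector [u, a], vector [b, p]]"
  using assms
proof (induction "nat (u + a + b + p)" arbitrary: u a b p rule: less_induct)
  case less
  have "u * p > 0" using less.prems mult_nonneg_nonneg[of a b] by linarith
  then have pos: "u > 0" "p > 0"
    using less.prems by (auto simp: zero_less_mult_iff)
  consider "b \<le> u" "p \<le> a" | "u \<le> b" "a \<le> p" | "b < u" "a < p" | "u < b" "p < a"
    by linarith
  then show ?case
  proof cases
    case 1
    obtain w where w: "word_mat 1 w = vector [vector [u - b, a - p], vector [b, p]]"
      using less.hyps[of "u - b" "a - p" b p] less.prems pos 1 by (auto simp: algebra_simps)
    have "word_mat 1 (False # w) = vector [vector [u, a], vector [b, p]]"
      by (simp add: w gen_mat_def vec_eq_iff forall_2 matrix_matrix_mult_def sum_2)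
    then show ?thesis by blast
  next
    case 2
    obtain w where w: "word_mat 1 w = vector [vector [u, a], vector [b - u, p - a]]"
      using less.hyps[of u a "b - u" "p - a"] less.prems pos 2 by (auto simp: algebra_simps)
    have "word_mat 1 (True # w) = vector [vector [u, a], vector [b, p]]"
      by (simp add: w gen_mat_def vec_eq_iff forall_2 matrix_matrix_mult_def sum_2)
    then show ?thesis by blast
  next
    case 3
    \<comment> \<open>With determinant 1 this bound leaves \<open>a + b \<le> 0\<close>, so
      incomparable rows occur only for the identity matrix, the empty word.\<close>
    have "(b + 1) * (a + 1) \<le> u * p"
      using 3 less.prems by (intro mult_mono) auto
    then have "a = 0" "b = 0" using less.prems by (auto simp: algebra_simps)
    moreover from this have "u = 1" "p = 1"
      using less.prems pos zmult_eq_1_iff[of u p] by auto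
    ultimately have "word_mat 1 [] = vector [vector [u, a], vector [b, p]]"
      by (simp add: vec_eq_iff forall_2 mat_def)
    then show ?thesis by blast
  next
    case 4
    have "u * p \<le> b * a" using 4 less.prems by (intro mult_mono) auto
    then show ?thesis using less.prems by (simp add: mult.commute)
  qed
qed

section \<open>Action of the generators on q-rationals\<close>

lemma qvar_neq: "qvar \<noteq> 0" "qvar \<noteq> 1"
  by (simp_all add: qvar_def Zero_fract_def One_fract_def eq_fract one_pCons)

lemma qint_add_1: "qint (c + 1) = qvar * qint c + 1"
  using qvar_neq by (simp add: qint_def power_int_add divide_simps) (simp add: algebra_simps)

lemma Mq_minus_add_1: "Mq_minus (c + 1) = gen_mat qvar False ** Mq_minus c"
  using qvar_neq
  by (simp add: Mq_minus_def gen_mat_def qint_add_1 vec_eq_iff forall_2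
      matrix_matrix_mult_def sum_2 power_int_diff)

lemma neg_cf_eqI: "is_neg_cf_expansion \<alpha> cs \<Longrightarrow> neg_cf \<alpha> = cs"
  unfolding neg_cf_def using is_neg_cf_expansion_unique by blast

lemma is_neg_cf_expansion_neg_cf: "\<alpha> > 1 \<Longrightarrow> is_neg_cf_expansion \<alpha> (neg_cf \<alpha>)"
  unfolding neg_cf_def by (rule theI') (rule is_neg_cf_expansion_ex1)

text \<open>Adding 1 to \<alpha> increments only the first coefficient of its expansion, and
  \<open>Mq_minus_add_1\<close> turns this into a left factor \<open>A\<close>.\<close>

lemma qRS_vec_add_1:
  assumes "\<alpha> > 1"
  shows "qRS_vec (\<alpha> + 1) = gen_mat qvar False *v qRS_vec \<alpha>"
proof -
  obtain c cs where c: "neg_cf \<alpha> = c # cs"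
    using is_neg_cf_expansion_neg_cf[OF assms]
    by (cases "neg_cf \<alpha>") (auto simp: is_neg_cf_expansion_def)
  have "is_neg_cf_expansion (\<alpha> + 1) ((c + 1) # cs)"
    using is_neg_cf_expansion_neg_cf[OF assms] unfolding c
    by (cases cs) (auto simp: is_neg_cf_expansion_def)
  then have "neg_cf (\<alpha> + 1) = (c + 1) # cs" by (rule neg_cf_eqI)
  then show ?thesis
    by (simp add: qRS_vec_def c Mq_minus_add_1 matrix_vector_mul_assoc matrix_mul_assoc)
qed

lemma qRS_vec_2_minus_inverse:
  assumes "\<alpha> > 1"
  shows "qRS_vec (2 - 1 / \<alpha>) = Mq_minus 2 *v qRS_vec \<alpha>"
proof -
  have "is_neg_cf_expansion (2 - 1 / \<alpha>) (2 # neg_cf \<alpha>)"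
    using is_neg_cf_expansion_neg_cf[OF assms]
    by (auto simp: is_neg_cf_expansion_def neg_cfrac_Cons)
  then have "neg_cf (2 - 1 / \<alpha>) = 2 # neg_cf \<alpha>" by (rule neg_cf_eqI)
  then show ?thesis by (simp add: qRS_vec_def matrix_vector_mul_assoc)
qed

definition qRS :: "rat \<Rightarrow> qfun ^ 2" where
  "qRS x = vector [qR x, qS x]"

lemma qRS_gt_1: "x > 1 \<Longrightarrow> qRS x = qRS_vec x"
  by (simp add: qRS_def vec_eq_iff forall_2 qR.simps[of x] qS.simps[of x])

text \<open>For \<open>x \<le> 1\<close> this is the defining recursion solved for the values at
  \<open>x + 1\<close>.\<close>

lemma qRS_add_1: "qRS (x + 1) = gen_mat qvar False *v qRS x"
proof (cases "x > 1")
  case True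
  then show ?thesis by (simp add: qRS_gt_1 qRS_vec_add_1)
next
  case False
  then show ?thesis
    using qvar_neq
    by (simp add: qRS_def vec_eq_iff forall_2 qR.simps[of x] qS.simps[of x] gen_mat_def
        matrix_vector_mult_def sum_2 flip: mult.assoc)
qed

lemma qS_add_1: "qS (x + 1) = qS x"
  using arg_cong[OF qRS_add_1[of x], of "\<lambda>v. v $ 2"]
  by (simp add: qRS_def gen_mat_def matrix_vector_mult_def sum_2)

lemma qS_add_int: "qS (x + of_int n) = qS x"
proof (induction n rule: int_induct[where k = 0])
  case (step1 i)
  then show ?case using qS_add_1[of "x + of_int i"] by (simp add: add.assoc)
next
  case (step2 i)
  then show ?case using qS_add_1[of "x + of_int (i - 1)"] by (simp add: add.assoc)
qed simp

lemma gen_mat_False_cancel: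
  assumes "gen_mat qvar False *v v = gen_mat qvar False *v w"
  shows "v = w"
  using assms qvar_neq
  by (auto simp: gen_mat_def vec_eq_iff forall_2 matrix_vector_mult_def sum_2)

text \<open>Two shifts carry 0 to 2, the first integer above 1, where the expansion is
  \<open>[2]\<close>; cancelling \<open>A\<close> twice leads back.\<close>

lemma qRS_0: "qRS 0 = vector [0, 1]"
proof -
  have "neg_cf 2 = [2]" by (rule neg_cf_eqI) (simp add: is_neg_cf_expansion_def)
  moreover have "qint 2 = qvar + 1"
    using qint_add_1[of 1] qvar_neq by (simp add: qint_def)
  ultimately have "qRS_vec 2 = vector [qvar + 1, 1]"
    by (simp add: qRS_vec_def Mq_minus_def vec_eq_iff forall_2 matrix_vector_mult_def sum_2)
  also have "\<dots> = gen_mat qvar False *v (gen_mat qvar False *v vector [0, 1])"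
    by (simp add: gen_mat_def vec_eq_iff forall_2 matrix_vector_mult_def sum_2)
  also have "qRS_vec 2 = gen_mat qvar False *v (gen_mat qvar False *v qRS 0)"
    using qRS_add_1[of 0] qRS_add_1[of 1] qRS_gt_1[of 2] by simp
  finally show ?thesis by (blast dest: gen_mat_False_cancel)
qed

text \<open>For \<open>x > 0\<close>, shifting \<open>x / (x + 1)\<close> by 1 gives
  \<open>2 - 1 / (x + 1)\<close>, whose expansion is that of \<open>x + 1\<close> with a 2 in front.
  The case \<open>x = 0\<close> is separate because \<open>x + 1\<close> must exceed 1 to have an
  expansion.\<close>

lemma qRS_div_add_1:
  assumes "x \<ge> 0"
  shows "qRS (x / (x + 1)) = gen_mat qvar True *v qRS x"
proof (cases "x = 0")
  case True
  then show ?thesis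
    by (simp add: qRS_0 gen_mat_def vec_eq_iff forall_2 matrix_vector_mult_def sum_2)
next
  case False
  with assms have x: "x > 0" by simp
  have eq: "x / (x + 1) + 1 = 2 - 1 / (x + 1)" using x by (simp add: field_simps)
  have "2 - 1 / (x + 1) > 1" using x by (simp add: field_simps)
  then have "qRS (x / (x + 1) + 1) = qRS_vec (2 - 1 / (x + 1))"
    by (simp only: eq qRS_gt_1)
  also have "\<dots> = Mq_minus 2 *v qRS (x + 1)"
    using x by (simp add: qRS_vec_2_minus_inverse qRS_gt_1)
  also have "\<dots> = (Mq_minus 2 ** gen_mat qvar False) *v qRS x"
    by (simp add: qRS_add_1 matrix_vector_mul_assoc)
  \<comment> \<open>This relation moves an \<open>A\<close> to the left, where it cancels against
    the initial shift and leaves \<open>B\<close>.\<close>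
  also have "Mq_minus 2 ** gen_mat qvar False = gen_mat qvar False ** gen_mat qvar True"
    using qint_add_1[of 1] qvar_neq
    by (simp add: Mq_minus_def gen_mat_def vec_eq_iff forall_2 matrix_matrix_mult_def sum_2
        qint_def algebra_simps)
  finally have "gen_mat qvar False *v qRS (x / (x + 1))
      = gen_mat qvar False *v (gen_mat qvar True *v qRS x)"
    by (simp add: qRS_add_1 matrix_vector_mul_assoc)
  then show ?thesis by (rule gen_mat_False_cancel)
qed

section \<open>From words to values of \<open>qS\<close>\<close>

text \<open>Start from 0 = 0/1 and read the word from its right end: each letter changes the
  fraction in the second column to \<open>x + 1\<close> or \<open>x / (x + 1)\<close>, and the
  vector over \<open>qvar\<close> follows by the same letter. The sign conditions keep
  \<open>x \<ge> 0\<close>, as \<open>B\<close> requires.\<close>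

lemma word_mat_column_2:
  fixes w :: "bool list"
  defines "N \<equiv> word_mat (1::int) w"
  shows "N $ 1 $ 2 \<ge> 0 \<and> N $ 2 $ 2 > 0 \<and>
    qRS (of_int (N $ 1 $ 2) / of_int (N $ 2 $ 2)) = word_mat qvar w *v vector [0, 1]"
  unfolding N_def
proof (induction w)
  case Nil
  have "mat 1 $ 1 $ (2::2) = (0::int)" "mat 1 $ 2 $ (2::2) = (1::int)"
    by (simp_all add: mat_def)
  then show ?case by (simp add: qRS_0)
next
  case (Cons l w)
  define a p where "a = word_mat (1::int) w $ 1 $ 2" and "p = word_mat (1::int) w $ 2 $ 2"
  have IH: "a \<ge> 0" "p > 0" "qRS (of_int a / of_int p) = word_mat qvar w *v vector [0, 1]"
    using Cons.IH by (simp_all add: a_def p_def)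
  show ?case
  proof (cases l)
    case True
    have "word_mat (1::int) (l # w) $ 1 $ 2 = a" "word_mat (1::int) (l # w) $ 2 $ 2 = a + p"
      using True by (simp_all add: a_def p_def gen_mat_def matrix_matrix_mult_def sum_2)
    moreover have "qRS (of_int a / of_int (a + p)) = word_mat qvar (l # w) *v vector [0, 1]"
    proof -
      have "rat_of_int a / of_int (a + p) = of_int a / of_int p / (of_int a / of_int p + 1)"
        using IH by (simp add: field_simps)
      moreover have "rat_of_int a / of_int p \<ge> 0" using IH by simp
      ultimately have "qRS (of_int a / of_int (a + p))
          = gen_mat qvar True *v qRS (of_int a / of_int p)"
        by (simp only: qRS_div_add_1)
      then show ?thesis using IH True by (simp add: matrix_vector_mul_assoc)
    qed
    ultimately show ?thesis using IH by simp
  next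
    case False
    have "word_mat (1::int) (l # w) $ 1 $ 2 = a + p" "word_mat (1::int) (l # w) $ 2 $ 2 = p"
      using False by (simp_all add: a_def p_def gen_mat_def matrix_matrix_mult_def sum_2)
    moreover have "rat_of_int (a + p) / of_int p = of_int a / of_int p + 1"
      using IH by (simp add: field_simps)
    ultimately show ?thesis
      using IH False by (simp add: qRS_add_1 matrix_vector_mul_assoc)
  qed
qed

lemma qS_word_mat:
  "qS (of_int (word_mat (1::int) w $ 1 $ 2) / of_int (word_mat (1::int) w $ 2 $ 2))
    = word_mat qvar w $ 2 $ 2"
  using arg_cong[OF conjunct2[OF conjunct2[OF word_mat_column_2[of w]]], of "\<lambda>v. v $ 2"]
  by (simp add: qRS_def matrix_vector_mult_def sum_2)

lemma qS_mod:
  assumes "p > 0"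
  shows "qS (of_int (a mod p) / of_int p) = qS (of_int a / of_int p)"
proof -
  have "rat_of_int a = of_int (a mod p) + of_int (a div p) * of_int p"
    by (simp flip: of_int_mult of_int_add)
  then have "rat_of_int a / of_int p = of_int (a mod p) / of_int p + of_int (a div p)"
    using assms by (simp add: field_simps)
  then show ?thesis by (simp add: qS_add_int)
qed

theorem theorem3p5:
  fixes p a b :: int
  assumes "p > 0"
    and "gcd a p = 1"
    and "gcd b p = 1"
    and "[a * b = -1] (mod p)"
  shows "qS (of_int a / of_int p) = qS (of_int b / of_int p)"
proof -
  define a' b' where "a' = a mod p" and "b' = b mod p"
  have nonneg: "a' \<ge> 0" "b' \<ge> 0" using assms(1) by (simp_all add: a'_def b'_def)
  have "[a' * b' = -1] (mod p)"
    using assms(4) by (simp add: a'_def b'_def cong_def mod_mult_eq)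
  then have "p dvd a' * b' + 1" by (simp add: cong_iff_dvd_diff)
  \<comment> \<open>\<open>u\<close> is the upper left entry that completes \<open>a'\<close>,
    \<open>b'\<close>, \<open>p\<close> to a matrix of determinant 1.\<close>
  then obtain u where u: "a' * b' + 1 = p * u" by (rule dvdE)
  have "p * u > 0" using nonneg mult_nonneg_nonneg[of a' b'] u by linarith
  then have "u \<ge> 0" using assms(1) by (simp add: zero_less_mult_iff)
  then obtain w where w: "word_mat 1 w = vector [vector [u, a'], vector [b', p]]"
    using ex_word_mat[of u a' b' p] nonneg assms(1) u by (auto simp: mult.commute)
  have "qS (of_int a' / of_int p) = word_mat qvar w $ 2 $ 2"
    using qS_word_mat[of w] by (simp add: w)
  \<comment> \<open>At \<open>q = 1\<close> the reversed and swapped word has second column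
    \<open>(b', p)\<close>.\<close>
  also have "\<dots> = qS (of_int b' / of_int p)"
    using qS_word_mat[of "rev (map Not w)"] by (simp add: word_mat_rev_nth w)
  finally show ?thesis
    using assms(1) by (simp add: a'_def b'_def qS_mod)
qed

end
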